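(* If $t>1$, then $\mathrm{DCO}(M)$ is nowhere dense in $\mathrm{DO}(M)$, and $\mathrm{DCO}(N)$ is nowhere dense in $\mathrm{DO}(N)$.
   Context: $K$ is a field, $K[X]=K[X_1,\dots,X_t]$ the commutative polynomial ring in $t$ indeterminates, $M=\{X^\nu\mid\nu\in\mathbb{N}_0^t\}$ its set of monomials. $A$ is an associative, not necessarily commutative $K$-algebra with a fixed $K$-module isomorphism $\Phi:A\to K[X]$ (not necessarily multiplicative), and $N=\Phi^{-1}(M)$. For a set $S$, $\mathrm{TO}(S)$ is the set of all total orderings on $S$ (antisymmetric, transitive, total binary relations), with the coarsest topology for which all sets $\mathfrak{U}_{(a,b)}=\{{\preceq}\in\mathrm{TO}(S)\mid a\preceq b\}$ are open; subsets carry the relative topology. Let $\phi:\mathrm{TO}(N)\to\mathrm{TO}(M)$ be the bijection given by $\Phi(n)\,\phi({\preceq})\,\Phi(n')\Leftrightarrow n\preceq n'$. $\mathrm{DO}(M)$ (degree orderings) is the set of ${\leq}\in\mathrm{TO}(M)$ such that for every nonzero $p\in K[X]$ the $\leq$-maximal monomial occurring in $p$ with nonzero coefficient has total degree $\deg(p)$. $\mathrm{CO}(M)$ (compatible orderings) is the set of ${\leq}\in\mathrm{TO}(M)$ with $X^\upsilon\leq X^\nu\Rightarrow X^{\upsilon+\gamma}\leq X^{\nu+\gamma}$ for all $\upsilon,\nu,\gamma\in\mathbb{N}_0^t$. $\mathrm{DCO}(M)=\mathrm{DO}(M)\cap\mathrm{CO}(M)$. $\mathrm{DO}(N)=\phi^{-1}(\mathrm{DO}(M))$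 and $\mathrm{DCO}(N)=\phi^{-1}(\mathrm{DCO}(M))$. *)

theory Defs
  imports "HOL-Analysis.Analysis" "HOL-Library.Poly_Mapping"
begin

section \<open>Polynomials in finitely many indeterminates\<close>

text \<open>
  The indeterminates are indexed by a finite type \<open>'x\<close>, so that \<open>t = CARD('x)\<close>. An exponent
  vector is an element of \<open>'x \<Rightarrow>\<^sub>0 nat\<close>, and the polynomial ring is \<open>('x \<Rightarrow>\<^sub>0 nat) \<Rightarrow>\<^sub>0 'k\<close> with the
  convolution product of \<^theory>\<open>HOL-Library.Poly_Mapping\<close>.
\<close>

type_synonym ('x, 'k) mpoly = "('x \<Rightarrow>\<^sub>0 nat) \<Rightarrow>\<^sub>0 'k"

definition mpoly_scale :: "'k::field \<Rightarrow> ('x::finite, 'k) mpoly \<Rightarrow> ('x, 'k) mpoly" where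
  "mpoly_scale c p = Poly_Mapping.map (\<lambda>a. c * a) p"

definition monom_of :: "('x::finite \<Rightarrow>\<^sub>0 nat) \<Rightarrow> ('x, 'k::field) mpoly" where
  "monom_of \<nu> = Poly_Mapping.single \<nu> 1"

definition Monoms :: "('x::finite, 'k::field) mpoly set" where
  "Monoms = range monom_of"

definition occurring :: "('x::finite, 'k::field) mpoly \<Rightarrow> ('x, 'k) mpoly set" where
  "occurring p = {monom_of \<nu> | \<nu>. Poly_Mapping.lookup p \<nu> \<noteq> 0}"

definition exp_degree :: "('x::finite \<Rightarrow>\<^sub>0 nat) \<Rightarrow> nat" where
  "exp_degree \<nu> = (\<Sum>x\<in>UNIV. Poly_Mapping.lookup \<nu> x)"

text \<open>Only meaningful for \<open>p \<noteq> 0\<close>.\<close>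

definition total_degree :: "('x::finite, 'k::field) mpoly \<Rightarrow> nat" where
  "total_degree p = Max (exp_degree ` Poly_Mapping.keys p)"


section \<open>Associative algebras\<close>

text \<open>Neither commutativity nor the existence of a unit element is assumed.\<close>

locale assoc_algebra = module scale
  for scale :: "'k::field \<Rightarrow> 'a::ring \<Rightarrow> 'a" +
  assumes scale_mult_left: "scale c a * b = scale c (a * b)"
    and scale_mult_right: "a * scale c b = scale c (a * b)"


section \<open>Total orderings and their topology\<close>

text \<open>
  \<open>linear_order_on S r\<close> includes \<open>r \<subseteq> S \<times> S\<close> and reflexivity, i.e. totality in the sense that
  \<open>a \<preceq> b\<close> or \<open>b \<preceq> a\<close> for all \<open>a\<close> and \<open>b\<close>, equal or not.
\<close>

definition TO :: "'s set \<Rightarrow> 's rel set" where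
  "TO S = {r. linear_order_on S r}"

definition TO_sub :: "'s set \<Rightarrow> 's \<Rightarrow> 's \<Rightarrow> 's rel set" where
  "TO_sub S a b = {r \<in> TO S. (a, b) \<in> r}"

text \<open>
  \<open>TO S\<close> itself is inserted into the subbasis only to get the right carrier for \<open>S = {}\<close>;
  for nonempty \<open>S\<close> it equals \<open>TO_sub S a a\<close>.
\<close>

definition TO_topology :: "'s set \<Rightarrow> 's rel topology" where
  "TO_topology S =
     topology_generated_by (insert (TO S) {TO_sub S a b | a b. a \<in> S \<and> b \<in> S})"

definition nowhere_dense_in :: "'b topology \<Rightarrow> 'b set \<Rightarrow> bool" where
  "nowhere_dense_in T D \<longleftrightarrow> D \<subseteq> topspace T \<and> T interior_of (T closure_of D) = {}"


section \<open>Degree orderings and compatible orderings\<close>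

text \<open>
  The monomial \<open>m\<close> below is the \<open>r\<close>-maximal monomial of \<open>p\<close>; it exists and is unique because
  \<open>r\<close> is a total ordering and \<open>occurring p\<close> is finite and nonempty.
\<close>

definition DO_M :: "('x::finite, 'k::field) mpoly rel set" where
  "DO_M = {r \<in> TO Monoms. \<forall>p. p \<noteq> 0 \<longrightarrow>
     (\<exists>m \<in> occurring p. (\<forall>m' \<in> occurring p. (m', m) \<in> r) \<and> total_degree m = total_degree p)}"

definition CO_M :: "('x::finite, 'k::field) mpoly rel set" where
  "CO_M = {r \<in> TO Monoms. \<forall>\<upsilon> \<nu> \<gamma>.
     (monom_of \<upsilon>, monom_of \<nu>) \<in> r \<longrightarrow> (monom_of (\<upsilon> + \<gamma>), monom_of (\<nu> + \<gamma>)) \<in> r}"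

definition DCO_M :: "('x::finite, 'k::field) mpoly rel set" where
  "DCO_M = DO_M \<inter> CO_M"


section \<open>Transport along a linear isomorphism\<close>

definition N_of :: "('a \<Rightarrow> ('x::finite, 'k::field) mpoly) \<Rightarrow> 'a set" where
  "N_of \<Phi> = \<Phi> -` Monoms"

definition phi :: "('a \<Rightarrow> ('x::finite, 'k::field) mpoly) \<Rightarrow> 'a rel \<Rightarrow> ('x, 'k) mpoly rel" where
  "phi \<Phi> r = {(\<Phi> n, \<Phi> n') | n n'. (n, n') \<in> r}"

lemma phi_iff: "bij \<Phi> \<Longrightarrow> (\<Phi> n, \<Phi> n') \<in> phi \<Phi> r \<longleftrightarrow> (n, n') \<in> r"
  unfolding phi_def by (auto simp: bij_def inj_eq)

definition DO_N :: "('a \<Rightarrow> ('x::finite, 'k::field) mpoly) \<Rightarrow> 'a rel set" where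
  "DO_N \<Phi> = {r \<in> TO (N_of \<Phi>). phi \<Phi> r \<in> DO_M}"

definition DCO_N :: "('a \<Rightarrow> ('x::finite, 'k::field) mpoly) \<Rightarrow> 'a rel set" where
  "DCO_N \<Phi> = {r \<in> TO (N_of \<Phi>). phi \<Phi> r \<in> DCO_M}"

end

theory Submission
  imports Defs
begin

text \<open>
  A neighbourhood of a degree ordering \<open>r\<close> constrains only finitely many monomials. Beyond their
  degrees, pick \<open>d\<close> and compare \<open>X\<^sub>i w\<close> with \<open>X\<^sub>j w\<close> for \<open>w = X\<^sub>i\<^sup>d\<close> and for \<open>w = X\<^sub>j\<^sup>d\<close>. A compatible
  ordering gives the same answer twice. If \<open>r\<close> does so too, swapping \<open>X\<^sub>i X\<^sub>i\<^sup>d\<close> and \<open>X\<^sub>j X\<^sub>i\<^sup>d\<close> in \<open>r\<close>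
  yields a degree ordering in the same neighbourhood with two different answers, and having
  different answers is an open condition.
\<close>

section \<open>Total orderings and their relabelling\<close>

lemma TO_D:
  assumes "r \<in> TO S"
  shows "r \<subseteq> S \<times> S" "trans r" "antisym r" "x \<in> S \<Longrightarrow> (x, x) \<in> r"
    "x \<in> S \<Longrightarrow> y \<in> S \<Longrightarrow> (x, y) \<in> r \<or> (y, x) \<in> r"
  using assms
  unfolding TO_def linear_order_on_def partial_order_on_def preorder_on_def refl_on_def total_on_def
  by (simp_all, metis)

text \<open>Renaming each \<open>h x\<close> to \<open>g x\<close> carries over the order axioms;
  injectivity of \<open>h\<close> is what turns \<open>h x = h y\<close> into \<open>x = y\<close>
  for antisymmetry. It serves both to permute the monomials inside one set and to move orderings
  from one set to another.\<close>

lemma TO_pullback: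
  assumes r: "r \<in> TO (range h)" and h: "inj h" and g: "inj g"
  shows "{(g x, g y) | x y. (h x, h y) \<in> r} \<in> TO (range g)"
proof -
  note r = TO_D[OF r]
  let ?s = "{(g x, g y) | x y. (h x, h y) \<in> r}"
  have mem: "(g x, g y) \<in> ?s \<longleftrightarrow> (h x, h y) \<in> r" for x y
    using g by (auto simp: inj_eq)
  have "trans ?s"
    using g transD[OF r(2)] by (auto simp: trans_def inj_eq)
  moreover have "antisym ?s"
    using g h antisymD[OF r(3)] by (auto simp: antisym_def inj_eq) (metis injD)
  moreover have "?s \<subseteq> range g \<times> range g" by auto
  moreover have "refl_on (range g) ?s"
    unfolding refl_on_def using mem r(4) by blast
  moreover have "total_on (range g) ?s"
    unfolding total_on_def using mem r(5) by blast
  ultimately show ?thesis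
    unfolding TO_def linear_order_on_def partial_order_on_def preorder_on_def by blast
qed

lemma TO_finite_has_greatest:
  assumes r: "r \<in> TO S" and "finite F" "F \<noteq> {}" "F \<subseteq> S"
  shows "\<exists>m\<in>F. \<forall>x\<in>F. (x, m) \<in> r"
  using assms(2-4)
proof (induction F rule: finite_ne_induct)
  case (singleton x)
  then show ?case using TO_D(4)[OF r] by auto
next
  case (insert x F)
  then obtain m where m: "m \<in> F" "\<forall>y\<in>F. (y, m) \<in> r" by auto
  have "(x, m) \<in> r \<or> (m, x) \<in> r" "(x, x) \<in> r"
    using TO_D(4,5)[OF r] insert.prems m(1) by auto
  moreover have "(y, x) \<in> r" if "(m, x) \<in> r" "y \<in> F" for y
    using that m(2) transD[OF TO_D(2)[OF r]] by blast
  ultimately show ?case using m by blast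
qed

section \<open>The topology on total orderings\<close>

lemma topspace_TO_topology [simp]: "topspace (TO_topology S) = TO S"
  unfolding TO_topology_def topology_generated_by_topspace by (auto simp: TO_sub_def)

lemma openin_TO_sub:
  assumes "a \<in> S" "b \<in> S"
  shows "openin (TO_topology S) (TO_sub S a b)"
  unfolding TO_topology_def by (rule topology_generated_by_Basis) (use assms in auto)

text \<open>A basic neighbourhood is a finite intersection of subbasic sets, each fixing one
  comparison; \<open>F\<close> collects the elements compared. Intersections take the union of two
  such sets, and a union of open sets uses the set of a member containing \<open>r\<close>.\<close>

lemma openin_TO_topology_finite_determined:
  assumes "openin (TO_topology S) V" "r \<in> V"
  obtains F where "finite F"
    "\<And>s. s \<in> TO S \<Longrightarrow> (\<And>a b. a \<in> F \<Longrightarrow> b \<in> F \<Longrightarrow> (a, b) \<in> r \<Longrightarrow> (a, b) \<in> s) \<Longrightarrow> s \<in> V"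
proof -
  have "generate_topology_on (insert (TO S) {TO_sub S a b | a b. a \<in> S \<and> b \<in> S}) V"
    using assms(1) by (simp add: TO_topology_def openin_topology_generated_by_iff)
  then have "r \<in> V \<Longrightarrow> \<exists>F. finite F \<and>
      (\<forall>s\<in>TO S. (\<forall>a\<in>F. \<forall>b\<in>F. (a, b) \<in> r \<longrightarrow> (a, b) \<in> s) \<longrightarrow> s \<in> V)"
  proof (induction V rule: generate_topology_on.induct)
    case (Int V W)
    then obtain F G where "finite F" "finite G"
      "\<forall>s\<in>TO S. (\<forall>a\<in>F. \<forall>b\<in>F. (a, b) \<in> r \<longrightarrow> (a, b) \<in> s) \<longrightarrow> s \<in> V"
      "\<forall>s\<in>TO S. (\<forall>a\<in>G. \<forall>b\<in>G. (a, b) \<in> r \<longrightarrow> (a, b) \<in> s) \<longrightarrow> s \<in> W"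
      by blast
    then show ?case by (intro exI[of _ "F \<union> G"]) auto
  next
    case (UN K)
    then show ?case by (meson Union_iff)
  next
    case (Basis V)
    then consider "V = TO S" | a b where "V = TO_sub S a b" by auto
    then show ?case
    proof cases
      case 2
      then show ?thesis using Basis(2)
        by (intro exI[of _ "{a, b}"]) (auto simp: TO_sub_def)
    qed auto
  qed simp
  with assms(2) that show thesis by metis
qed

section \<open>Degree orderings and compatible orderings on an indexed set\<close>

definition degree_orders :: "(('x::finite \<Rightarrow>\<^sub>0 nat) \<Rightarrow> 's) \<Rightarrow> 's rel set" where
  "degree_orders g = {r \<in> TO (range g). \<forall>\<upsilon> \<nu>. exp_degree \<upsilon> < exp_degree \<nu> \<longrightarrow> (g \<upsilon>, g \<nu>) \<in> r}"

definition compatible_orders :: "(('x::finite \<Rightarrow>\<^sub>0 nat) \<Rightarrow> 's) \<Rightarrow> 's rel set" where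
  "compatible_orders g =
     {r \<in> TO (range g). \<forall>\<upsilon> \<nu> \<gamma>. (g \<upsilon>, g \<nu>) \<in> r \<longrightarrow> (g (\<upsilon> + \<gamma>), g (\<nu> + \<gamma>)) \<in> r}"

lemma exp_degree_add: "exp_degree (\<upsilon> + \<nu>) = exp_degree \<upsilon> + exp_degree \<nu>"
  by (simp add: exp_degree_def lookup_add sum.distrib)

lemma exp_degree_single [simp]: "exp_degree (Poly_Mapping.single i n) = n"
  by (simp add: exp_degree_def lookup_single when_def)

text \<open>For a permutation \<pi> of the exponents, \<open>g \<circ> \<pi>\<close> is a second
  injective enumeration of \<open>range g\<close>, so the new relation is a pullback of
  \<open>r\<close>. As \<pi> keeps degrees, a strict degree inequality still forces the
  comparison.\<close>

lemma degree_orders_permute: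
  assumes r: "r \<in> degree_orders g" and g: "inj g" and \<pi>: "bij \<pi>"
    and deg: "\<And>\<nu>. exp_degree (\<pi> \<nu>) = exp_degree \<nu>"
  shows "{(g \<upsilon>, g \<nu>) | \<upsilon> \<nu>. (g (\<pi> \<upsilon>), g (\<pi> \<nu>)) \<in> r} \<in> degree_orders g"
proof -
  have "range (g \<circ> \<pi>) = range g"
    using \<pi> by (metis bij_is_surj image_comp)
  moreover have "inj (g \<circ> \<pi>)"
    using g \<pi> by (simp add: bij_is_inj inj_compose)
  ultimately show ?thesis
    using TO_pullback[of r "g \<circ> \<pi>" g] r g deg by (auto simp: degree_orders_def) metis
qed

section \<open>Incompatibility as an open condition met by every neighbourhood\<close>

definition incompatible_at ::
  "(('x::finite \<Rightarrow>\<^sub>0 nat) \<Rightarrow> 's) \<Rightarrow>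
     ('x \<Rightarrow>\<^sub>0 nat) \<Rightarrow> ('x \<Rightarrow>\<^sub>0 nat) \<Rightarrow> ('x \<Rightarrow>\<^sub>0 nat) \<Rightarrow> ('x \<Rightarrow>\<^sub>0 nat) \<Rightarrow> 's rel set"
  where
  "incompatible_at g \<upsilon> \<nu> \<gamma> \<gamma>' =
     TO_sub (range g) (g (\<upsilon> + \<gamma>)) (g (\<nu> + \<gamma>)) \<inter> TO_sub (range g) (g (\<nu> + \<gamma>')) (g (\<upsilon> + \<gamma>'))"

lemma openin_incompatible_at: "openin (TO_topology (range g)) (incompatible_at g \<upsilon> \<nu> \<gamma> \<gamma>')"
  unfolding incompatible_at_def by (intro openin_Int openin_TO_sub) auto

text \<open>However a compatible ordering compares \<open>g \<upsilon>\<close> and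
  \<open>g \<nu>\<close>, it repeats that answer after both shifts. One of the two prescribed
  comparisons is opposite, so antisymmetry and cancellation of the shift would give \<upsilon> =
  \<nu>.\<close>

lemma incompatible_at_disjoint_compatible:
  assumes g: "inj g" and ne: "\<upsilon> \<noteq> \<nu>"
  shows "incompatible_at g \<upsilon> \<nu> \<gamma> \<gamma>' \<inter> compatible_orders g = {}"
proof -
  have False if s: "s \<in> incompatible_at g \<upsilon> \<nu> \<gamma> \<gamma>'" and c: "s \<in> compatible_orders g" for s
  proof -
    have sT: "s \<in> TO (range g)" using c by (simp add: compatible_orders_def)
    have anti: "x = y" if "(g x, g y) \<in> s" "(g y, g x) \<in> s" for x y
      using antisymD[OF TO_D(3)[OF sT] that] g by (simp add: inj_eq)
    have comp: "(g (x + w), g (y + w)) \<in> s" if "(g x, g y) \<in> s" for x y w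
      using c that by (auto simp: compatible_orders_def)
    have s': "(g (\<upsilon> + \<gamma>), g (\<nu> + \<gamma>)) \<in> s" "(g (\<nu> + \<gamma>'), g (\<upsilon> + \<gamma>')) \<in> s"
      using s by (auto simp: incompatible_at_def TO_sub_def)
    have "(g \<upsilon>, g \<nu>) \<in> s \<or> (g \<nu>, g \<upsilon>) \<in> s" using TO_D(5)[OF sT] by blast
    then show False
    proof
      assume "(g \<upsilon>, g \<nu>) \<in> s"
      from anti[OF comp[OF this] s'(2)] ne show False by simp
    next
      assume "(g \<nu>, g \<upsilon>) \<in> s"
      from anti[OF comp[OF this] s'(1)] ne show False by simp
    qed
  qed
  then show ?thesis by blast
qed

lemma open_meets_incompatible_at:
  fixes g :: "('x::finite \<Rightarrow>\<^sub>0 nat) \<Rightarrow> 's"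
  assumes card: "CARD('x) > 1" and g: "inj g"
    and V: "openin (TO_topology (range g)) V" and r: "r \<in> V" "r \<in> degree_orders g"
  shows "\<exists>\<upsilon> \<nu> \<gamma> \<gamma>'. \<upsilon> \<noteq> \<nu> \<and> V \<inter> degree_orders g \<inter> incompatible_at g \<upsilon> \<nu> \<gamma> \<gamma>' \<noteq> {}"
proof -
  obtain i j :: 'x where ij: "i \<noteq> j"
    using card by (metis (full_types) UNIV_I card_le_Suc0_iff_eq finite One_nat_def not_le)
  obtain F where F: "finite F" "\<And>s. s \<in> TO (range g) \<Longrightarrow>
      (\<And>a b. a \<in> F \<Longrightarrow> b \<in> F \<Longrightarrow> (a, b) \<in> r \<Longrightarrow> (a, b) \<in> s) \<Longrightarrow> s \<in> V"
    using openin_TO_topology_finite_determined[OF V r(1)] by metis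
  \<comment> \<open>Injectivity of \<open>g\<close> leaves only finitely many exponents over
    \<open>F\<close>, so their degrees are bounded.\<close>
  have "finite (exp_degree ` (g -` F))"
    using F(1) g by (simp add: finite_vimageI)
  then obtain D where D: "\<And>\<nu>. g \<nu> \<in> F \<Longrightarrow> exp_degree \<nu> \<le> D"
    by (auto simp: finite_nat_set_iff_bounded_le)
  \<comment> \<open>The swapped exponents will have degree \<open>d + 1 > D\<close>, which keeps
    them out of \<open>F\<close>. Moreover \<open>d \<ge> 2\<close> separates \<open>u + w'\<close>
    from \<open>v + w\<close>; for \<open>d = 1\<close> the two would coincide.\<close>
  define d where "d = D + 2"
  define w where "w = Poly_Mapping.single i d"
  define w' where "w' = Poly_Mapping.single j d"
  define u where "u = Poly_Mapping.single i (1::nat)"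
  define v where "v = Poly_Mapping.single j (1::nat)"
  have rT: "r \<in> TO (range g)" using r by (simp add: degree_orders_def)
  have tot: "(g x, g y) \<in> r \<or> (g y, g x) \<in> r" for x y
    using TO_D(5)[OF rT] by blast
  have uv: "u \<noteq> v" using ij by (metis u_def v_def lookup_single_eq lookup_single_not_eq zero_neq_one)
  have inc: "s \<in> incompatible_at g x y z z' \<longleftrightarrow> s \<in> TO (range g) \<and>
     (g (x + z), g (y + z)) \<in> s \<and> (g (y + z'), g (x + z')) \<in> s" for s x y z z'
    by (auto simp: incompatible_at_def TO_sub_def)
  show ?thesis
  proof (cases "r \<in> incompatible_at g u v w w' \<or> r \<in> incompatible_at g v u w w'")
    case True
    then show ?thesis using r uv by (metis disjoint_iff IntI)
  next
    \<comment> \<open>By totality, \<open>r\<close> now orders the pair shifted by \<open>w\<close>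
      and the pair shifted by \<open>w'\<close> in the same direction.\<close>
    case False
    define \<pi> where "\<pi> = Transposition.transpose (u + w) (v + w)"
    define s where "s = {(g \<upsilon>, g \<nu>) | \<upsilon> \<nu>. (g (\<pi> \<upsilon>), g (\<pi> \<nu>)) \<in> r}"
    have s_iff: "(g \<upsilon>, g \<nu>) \<in> s \<longleftrightarrow> (g (\<pi> \<upsilon>), g (\<pi> \<nu>)) \<in> r" for \<upsilon> \<nu>
      using g by (auto simp: s_def inj_eq)
    have deg: "exp_degree (u + w) = d + 1" "exp_degree (v + w) = d + 1"
      by (simp_all add: exp_degree_add u_def v_def w_def)
    have sD: "s \<in> degree_orders g"
      unfolding s_def
    proof (rule degree_orders_permute[OF r(2) g])
      show "bij \<pi>" by (simp add: \<pi>_def)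
    qed (auto simp: \<pi>_def deg Transposition.transpose_def)
    then have sT: "s \<in> TO (range g)" by (simp add: degree_orders_def)
    have \<pi>_id: "\<pi> \<nu> = \<nu>" if "g \<nu> \<in> F" for \<nu>
      using D[OF that] deg unfolding \<pi>_def d_def by (auto simp: Transposition.transpose_def)
    have "s \<in> V"
    proof (rule F(2)[OF sT])
      fix a b assume "a \<in> F" "b \<in> F" "(a, b) \<in> r"
      moreover from this obtain \<upsilon> \<nu> where "a = g \<upsilon>" "b = g \<nu>"
        using TO_D(1)[OF rT] by blast
      ultimately show "(a, b) \<in> s" using s_iff \<pi>_id by simp
    qed
    \<comment> \<open>The swap reverses the comparison at \<open>w\<close> and leaves the one at
      \<open>w'\<close> alone. The direction chosen by \<open>r\<close> decides which disjunct
      holds.\<close>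
    moreover have "s \<in> incompatible_at g u v w w' \<or> s \<in> incompatible_at g v u w w'"
    proof -
      have l: "Poly_Mapping.lookup (u + w) i = d + 1" "Poly_Mapping.lookup (v + w) i = d"
        "Poly_Mapping.lookup (u + w') i = 1" "Poly_Mapping.lookup (v + w') i = 0"
        using ij by (simp_all add: lookup_add lookup_single u_def v_def w_def w'_def)
      have d: "d \<ge> 2" by (simp add: d_def)
      have ne: "u + w' \<noteq> u + w" "u + w' \<noteq> v + w" "v + w' \<noteq> u + w" "v + w' \<noteq> v + w"
        using l d by auto
      have "\<pi> (u + w) = v + w" "\<pi> (v + w) = u + w" "\<pi> (u + w') = u + w'" "\<pi> (v + w') = v + w'"
        using ne by (simp_all add: \<pi>_def)
      then show ?thesis
        using False tot[of "u + w" "v + w"] tot[of "u + w'" "v + w'"] rT sT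
        by (auto simp: inc s_iff)
    qed
    ultimately show ?thesis using sD uv by (metis disjoint_iff IntI)
  qed
qed

text \<open>A relatively open set inside the closure would contain an incompatible degree ordering
  \<open>s\<close>, but \<open>s\<close> has a relative neighbourhood free of compatible orderings
  and so lies outside the closure.\<close>

lemma nowhere_dense_compatible_orders:
  fixes g :: "('x::finite \<Rightarrow>\<^sub>0 nat) \<Rightarrow> 's"
  assumes g: "inj g" and card: "CARD('x) > 1"
  shows "nowhere_dense_in (subtopology (TO_topology (range g)) (degree_orders g))
           (degree_orders g \<inter> compatible_orders g)"
proof -
  let ?T = "TO_topology (range g)" and ?D = "degree_orders g" and ?C = "compatible_orders g"
  let ?X = "subtopology ?T ?D"
  have "r \<notin> ?X interior_of (?X closure_of (?D \<inter> ?C))" for r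
  proof
    assume "r \<in> ?X interior_of (?X closure_of (?D \<inter> ?C))"
    then obtain V where V: "openin ?T V" "r \<in> V" "r \<in> ?D"
      "V \<inter> ?D \<subseteq> ?X closure_of (?D \<inter> ?C)"
      by (auto simp: interior_of_def openin_subtopology)
    obtain s \<upsilon> \<nu> \<gamma> \<gamma>' where s: "s \<in> V" "s \<in> ?D" "s \<in> incompatible_at g \<upsilon> \<nu> \<gamma> \<gamma>'" and ne: "\<upsilon> \<noteq> \<nu>"
      using open_meets_incompatible_at[OF card g V(1-3)] by blast
    have "s \<in> ?X closure_of (?D \<inter> ?C)" using s V by blast
    moreover have "openin ?X (incompatible_at g \<upsilon> \<nu> \<gamma> \<gamma>' \<inter> ?D)"
      unfolding openin_subtopology by (rule exI, rule conjI[OF openin_incompatible_at refl])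
    ultimately obtain s' where "s' \<in> ?D \<inter> ?C" "s' \<in> incompatible_at g \<upsilon> \<nu> \<gamma> \<gamma>' \<inter> ?D"
      using s(2,3) by (auto simp: in_closure_of)
    then show False
      using incompatible_at_disjoint_compatible[OF g ne, of \<gamma> \<gamma>'] by blast
  qed
  then show ?thesis
    by (auto simp: nowhere_dense_in_def degree_orders_def)
qed

section \<open>The orderings of monomials as an instance\<close>

lemma inj_monom_of: "inj (monom_of :: ('x::finite \<Rightarrow>\<^sub>0 nat) \<Rightarrow> ('x, 'k::field) mpoly)"
  by (rule injI) (metis monom_of_def lookup_single_eq lookup_single_not_eq zero_neq_one)

lemma total_degree_monom_of [simp]:
  "total_degree (monom_of \<nu> :: ('x::finite, 'k::field) mpoly) = exp_degree \<nu>"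
  by (simp add: total_degree_def monom_of_def)

lemma occurring_eq: "occurring p = monom_of ` Poly_Mapping.keys p"
  by (auto simp: occurring_def in_keys_iff)

text \<open>The condition on all polynomials reduces to pairs by testing binomials. Conversely, the
  greatest monomial of a finite support has maximal degree, since a term of larger degree would lie
  above it.\<close>

lemma DO_M_eq_degree_orders:
  "(DO_M :: ('x::finite, 'k::field) mpoly rel set) = degree_orders monom_of"
proof (intro equalityI subsetI)
  fix r :: "('x, 'k) mpoly rel"
  assume r: "r \<in> DO_M"
  have "(monom_of \<upsilon>, monom_of \<nu>) \<in> r" if lt: "exp_degree \<upsilon> < exp_degree \<nu>" for \<upsilon> \<nu>
  proof -
    \<comment> \<open>Distinct exponents exclude cancellation, so both monomials occur, and only
      that of \<nu> has the total degree of the sum.\<close>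
    let ?p = "monom_of \<upsilon> + monom_of \<nu> :: ('x, 'k) mpoly"
    have "\<upsilon> \<noteq> \<nu>" using lt by auto
    then have k: "Poly_Mapping.keys ?p = {\<upsilon>, \<nu>}"
      by (auto simp: monom_of_def in_keys_iff lookup_add lookup_single when_def split: if_splits)
    then have "?p \<noteq> 0" by (metis insert_not_empty keys_zero)
    then obtain m where m: "m \<in> occurring ?p" "\<forall>m' \<in> occurring ?p. (m', m) \<in> r"
      "total_degree m = total_degree ?p"
      using r unfolding DO_M_def by blast
    have "total_degree ?p = exp_degree \<nu>"
      using lt by (simp add: total_degree_def k)
    then have "m = monom_of \<nu>"
      using m lt by (auto simp: occurring_eq k)
    then show ?thesis using m(2) by (simp add: occurring_eq k)
  qed
  then show "r \<in> degree_orders monom_of"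
    using r by (auto simp: degree_orders_def DO_M_def Monoms_def)
next
  fix r :: "('x, 'k) mpoly rel"
  assume r: "r \<in> degree_orders monom_of"
  then have rT: "r \<in> TO Monoms" by (simp add: degree_orders_def Monoms_def)
  have "\<exists>m \<in> occurring p. (\<forall>m' \<in> occurring p. (m', m) \<in> r) \<and> total_degree m = total_degree p"
    if p: "p \<noteq> 0" for p
  proof -
    have "\<exists>m \<in> occurring p. \<forall>m' \<in> occurring p. (m', m) \<in> r"
      by (rule TO_finite_has_greatest[OF rT]) (use p in \<open>auto simp: occurring_eq Monoms_def\<close>)
    then obtain \<nu> where \<nu>: "\<nu> \<in> Poly_Mapping.keys p"
      "\<And>\<upsilon>. \<upsilon> \<in> Poly_Mapping.keys p \<Longrightarrow> (monom_of \<upsilon>, monom_of \<nu>) \<in> r"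
      by (auto simp: occurring_eq)
    have "exp_degree \<upsilon> \<le> exp_degree \<nu>" if \<upsilon>: "\<upsilon> \<in> Poly_Mapping.keys p" for \<upsilon>
    proof (rule ccontr)
      assume n: "\<not> exp_degree \<upsilon> \<le> exp_degree \<nu>"
      then have "(monom_of \<nu>, monom_of \<upsilon>) \<in> r"
        using r by (auto simp: degree_orders_def)
      then have "monom_of \<nu> = (monom_of \<upsilon> :: ('x, 'k) mpoly)"
        using \<nu>(2)[OF \<upsilon>] TO_D(3)[OF rT] by (auto dest: antisymD)
      then show False using n inj_monom_of[where 'x = 'x and 'k = 'k] by (simp add: inj_eq)
    qed
    then have "total_degree p = exp_degree \<nu>"
      unfolding total_degree_def using \<nu>(1) by (intro Max_eqI) auto
    then show ?thesis using \<nu> by (auto simp: occurring_eq)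
  qed
  then show "r \<in> DO_M" using rT by (auto simp: DO_M_def)
qed

lemma CO_M_eq_compatible_orders: "CO_M = compatible_orders monom_of"
  by (simp add: CO_M_def compatible_orders_def Monoms_def)

section \<open>Transport along \<Phi>\<close>

context
  fixes \<Phi> :: "'a \<Rightarrow> ('x::finite, 'k::field) mpoly"
  assumes \<Phi>: "bij \<Phi>"
begin

lemma N_of_eq_range: "N_of \<Phi> = range (inv \<Phi> \<circ> monom_of)"
  using bij_vimage_eq_inv_image[OF \<Phi>] by (simp add: N_of_def Monoms_def image_comp)

lemma inj_inv_monom_of: "inj (inv \<Phi> \<circ> monom_of)"
  using \<Phi> by (intro inj_compose inj_monom_of) (simp add: bij_imp_bij_inv bij_is_inj)

lemma phi_monom_of_iff:
  "(monom_of \<upsilon>, monom_of \<nu>) \<in> phi \<Phi> r \<longleftrightarrow>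
     ((inv \<Phi> \<circ> monom_of) \<upsilon>, (inv \<Phi> \<circ> monom_of) \<nu>) \<in> r"
  using phi_iff[OF \<Phi>, of "inv \<Phi> (monom_of \<upsilon>)" "inv \<Phi> (monom_of \<nu>)" r]
  by (simp add: surj_f_inv_f bij_is_surj[OF \<Phi>])

text \<open>Every element of the image relation is a pair of monomials, which exhibits
  \<open>phi \<Phi> r\<close> as a pullback of \<open>r\<close> from the enumeration of
  \<open>N_of \<Phi>\<close> to that of \<open>Monoms\<close>.\<close>

lemma phi_in_TO:
  assumes r: "r \<in> TO (range (inv \<Phi> \<circ> monom_of))"
  shows "phi \<Phi> r \<in> TO (range monom_of)"
proof -
  have "phi \<Phi> r \<subseteq> Monoms \<times> Monoms"
    using TO_D(1)[OF r] N_of_eq_range by (auto simp: phi_def N_of_def)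
  then have "phi \<Phi> r = {(monom_of \<upsilon>, monom_of \<nu>) | \<upsilon> \<nu>.
      ((inv \<Phi> \<circ> monom_of) \<upsilon>, (inv \<Phi> \<circ> monom_of) \<nu>) \<in> r}"
    unfolding phi_monom_of_iff[symmetric] Monoms_def by blast
  with TO_pullback[OF r inj_inv_monom_of inj_monom_of] show ?thesis by simp
qed

lemma DO_N_eq_degree_orders: "DO_N \<Phi> = degree_orders (inv \<Phi> \<circ> monom_of)"
  unfolding DO_N_def DO_M_eq_degree_orders degree_orders_def N_of_eq_range
  using phi_in_TO by (simp add: phi_monom_of_iff cong: conj_cong)

lemma DCO_N_eq:
  "DCO_N \<Phi> = degree_orders (inv \<Phi> \<circ> monom_of) \<inter> compatible_orders (inv \<Phi> \<circ> monom_of)"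
  unfolding DCO_N_def DCO_M_def DO_M_eq_degree_orders CO_M_eq_compatible_orders
    degree_orders_def compatible_orders_def N_of_eq_range
  using phi_in_TO by (simp add: phi_monom_of_iff Collect_conj_eq[symmetric] cong: conj_cong)

end

theorem proposition7p3:
  fixes scale :: "'k::field \<Rightarrow> 'a::ring \<Rightarrow> 'a"
    and \<Phi> :: "'a \<Rightarrow> ('x::finite, 'k) mpoly"
  assumes "assoc_algebra scale"
    and "module_hom scale mpoly_scale \<Phi>"
    and "bij \<Phi>"
    and "CARD('x) > 1"
  shows "nowhere_dense_in
           (subtopology (TO_topology (Monoms :: ('x, 'k) mpoly set)) DO_M) DCO_M
       \<and> nowhere_dense_in (subtopology (TO_topology (N_of \<Phi>)) (DO_N \<Phi>)) (DCO_N \<Phi>)"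
  \<comment> \<open>Both claims become instances of the indexed result, with \<open>g\<close> equal
    to \<open>monom_of\<close> and to \<open>inv \<Phi> \<circ> monom_of\<close>.\<close>
  unfolding DCO_M_def DO_M_eq_degree_orders CO_M_eq_compatible_orders Monoms_def
    DO_N_eq_degree_orders[OF assms(3)] DCO_N_eq[OF assms(3)] N_of_eq_range[OF assms(3)]
  by (intro conjI nowhere_dense_compatible_orders inj_monom_of inj_inv_monom_of assms)

end
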